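(* Let $A\in\mathbb R^{p\times K}$ be a known matrix with columns in $\Delta_p$, and suppose $NX\sim\mathrm{Multinomial}_p(N;AT_* )$ with $T_*\in\Delta_K$. Let $1<s\le K$ and assume $s\le cN$ for some small constant $c>0$. Then there exist absolute constants $c_0>0$ and $c_1\in(0,1]$, depending on $c$ only, such that $$\inf_{\widehat T}\ \sup_{T_*\in\mathcal T'(s)}\mathbb P\left\{\|\widehat T-T_*\|_1\ge c_0\sqrt{\frac sN}\right\}\ge c_1,$$ where the infimum is taken over all estimators $\widehat T\in\Delta_K$ (measurable functions of $X$; $A$ is known).
   Context: $\Delta_d=\{x\in\mathbb R^d: x_j\ge 0\ \forall j,\ \sum_j x_j=1\}$; $p>K$ and $N\ge1$ are integers. $\mathcal T'(s)=\{T\in\Delta_K:|\mathrm{supp}(T)|=s,\ \min_{k\in\mathrm{supp}(T)}T_k\ge c_\star/s\}$, where $c_\star\in(0,1]$ is some (suitable) absolute constant. The probability $\mathbb P$ is with respect to the law of $X$ under the parameter $T_*$. *)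

theory Defs
  imports "HOL-Probability.Probability"
begin

text \<open>
  A vector of $R^d$ is a function that is extensional on the index set \<open>{..<d}\<close>, so that the
  dimensions can be quantified inside a formula. The measurable structure on $R^d$ is the
  product sigma-algebra \<open>\<Pi>\<^sub>M i\<in>{..<d}. borel\<close>.
\<close>

definition prob_simplex :: "nat \<Rightarrow> (nat \<Rightarrow> real) set" where
  "prob_simplex d = {x \<in> {..<d} \<rightarrow>\<^sub>E UNIV. (\<forall>j<d. 0 \<le> x j) \<and> (\<Sum>j<d. x j) = 1}"

definition vec_supp :: "nat \<Rightarrow> (nat \<Rightarrow> real) \<Rightarrow> nat set" where
  "vec_supp d x = {k. k < d \<and> x k \<noteq> 0}"

definition l1_norm :: "nat \<Rightarrow> (nat \<Rightarrow> real) \<Rightarrow> real" where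
  "l1_norm d x = (\<Sum>k<d. \<bar>x k\<bar>)"

text \<open>A matrix of size $p \times K$ is given by its entries \<open>A j k\<close> with \<open>j < p\<close> and \<open>k < K\<close>.\<close>

definition mat_column :: "nat \<Rightarrow> (nat \<Rightarrow> nat \<Rightarrow> real) \<Rightarrow> nat \<Rightarrow> nat \<Rightarrow> real" where
  "mat_column p A k = (\<lambda>j\<in>{..<p}. A j k)"

definition mat_vec :: "nat \<Rightarrow> nat \<Rightarrow> (nat \<Rightarrow> nat \<Rightarrow> real) \<Rightarrow> (nat \<Rightarrow> real) \<Rightarrow> nat \<Rightarrow> real" where
  "mat_vec p K A T = (\<lambda>j\<in>{..<p}. \<Sum>k<K. A j k * T k)"

definition count_vectors :: "nat \<Rightarrow> nat \<Rightarrow> (nat \<Rightarrow> nat) set" where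
  "count_vectors p N = {n \<in> {..<p} \<rightarrow>\<^sub>E UNIV. (\<Sum>j<p. n j) = N}"

definition multinomial_mass :: "nat \<Rightarrow> nat \<Rightarrow> (nat \<Rightarrow> real) \<Rightarrow> (nat \<Rightarrow> nat) \<Rightarrow> real" where
  "multinomial_mass p N q n = fact N / (\<Prod>j<p. fact (n j)) * (\<Prod>j<p. q j ^ n j)"

text \<open>
  The value is meaningful only for \<open>q \<in> prob_simplex p\<close>; in that case \<open>pmf_multinomial\<close> below
  shows that the given function is indeed the mass function.
\<close>

definition multinomial_pmf :: "nat \<Rightarrow> nat \<Rightarrow> (nat \<Rightarrow> real) \<Rightarrow> (nat \<Rightarrow> nat) pmf" where
  "multinomial_pmf p N q =
     embed_pmf (\<lambda>n. if n \<in> count_vectors p N then multinomial_mass p N q n else 0)"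

lemma count_vectors_0: "count_vectors 0 N = (if N = 0 then {\<lambda>_. undefined} else {})"
  by (auto simp: count_vectors_def)

lemma count_vectors_Suc:
  "count_vectors (Suc p) N = (\<Union>i\<in>{..N}. (\<lambda>n. n(p := i)) ` count_vectors p (N - i))"
proof (intro equalityI subsetI)
  fix n assume n: "n \<in> count_vectors (Suc p) N"
  then have s: "(\<Sum>j<p. n j) + n p = N" and e: "n \<in> {..<Suc p} \<rightarrow>\<^sub>E UNIV"
    by (auto simp: count_vectors_def)
  have "n(p := undefined) \<in> count_vectors p (N - n p)"
    using s e by (auto simp: count_vectors_def PiE_iff extensional_def)
  moreover have "n = (n(p := undefined))(p := n p)" by simp
  ultimately show "n \<in> (\<Union>i\<in>{..N}. (\<lambda>n. n(p := i)) ` count_vectors p (N - i))"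
    using s by (intro UN_I[of "n p"] image_eqI[of _ _ "n(p := undefined)"]) auto
qed (auto simp: count_vectors_def PiE_iff extensional_def)

lemma finite_count_vectors: "finite (count_vectors p N)"
  by (induction p arbitrary: N) (simp_all add: count_vectors_0 count_vectors_Suc)

lemma multinomial_theorem:
  "(\<Sum>n\<in>count_vectors p N. multinomial_mass p N q n) = (\<Sum>j<p. q j) ^ N"
proof (induction p arbitrary: N)
  case 0
  then show ?case by (simp add: count_vectors_0 multinomial_mass_def)
next
  case (Suc p)
  have inj: "inj_on (\<lambda>n. n(p := i)) (count_vectors p M)" for i M
  proof (rule inj_onI)
    fix m n assume mn: "m \<in> count_vectors p M" "n \<in> count_vectors p M" "m(p := i) = n(p := i)"
    then have "m p = n p"
      by (auto simp: count_vectors_def PiE_iff extensional_def)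
    with mn(3) show "m = n" by (metis fun_upd_triv fun_upd_upd)
  qed
  have mass: "multinomial_mass (Suc p) N q (n(p := i))
      = real (N choose i) * q p ^ i * multinomial_mass p (N - i) q n" if "i \<le> N" for n i
    using that by (simp add: multinomial_mass_def binomial_fact mult_ac)
  have "(\<Sum>n\<in>count_vectors (Suc p) N. multinomial_mass (Suc p) N q n)
      = (\<Sum>i\<le>N. \<Sum>n\<in>(\<lambda>n. n(p := i)) ` count_vectors p (N - i). multinomial_mass (Suc p) N q n)"
    unfolding count_vectors_Suc
    by (rule sum.UNION_disjoint) (auto simp: finite_count_vectors dest: fun_cong[where x = p])
  also have "\<dots> = (\<Sum>i\<le>N. \<Sum>n\<in>count_vectors p (N - i).
      real (N choose i) * q p ^ i * multinomial_mass p (N - i) q n)"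
    by (rule sum.cong[OF refl]) (subst sum.reindex[OF inj], simp add: mass o_def)
  also have "\<dots> = (\<Sum>i\<le>N. real (N choose i) * q p ^ i * (\<Sum>j<p. q j) ^ (N - i))"
    by (simp add: sum_distrib_left[symmetric] Suc.IH)
  also have "\<dots> = (\<Sum>j<Suc p. q j) ^ N"
    by (simp add: binomial_ring add.commute[of _ "q p"])
  finally show ?case .
qed

lemma pmf_multinomial:
  assumes "q \<in> prob_simplex p"
  shows "pmf (multinomial_pmf p N q) n
           = (if n \<in> count_vectors p N then multinomial_mass p N q n else 0)"
  unfolding multinomial_pmf_def
proof (rule pmf_embed_pmf)
  have q: "0 \<le> q j" if "j < p" for j using assms that by (simp add: prob_simplex_def)
  have nn: "0 \<le> multinomial_mass p N q n" for n
    using q by (auto simp: multinomial_mass_def intro!: mult_nonneg_nonneg divide_nonneg_nonneg prod_nonneg)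
  then show "0 \<le> (if n \<in> count_vectors p N then multinomial_mass p N q n else 0)" for n
    by simp
  have "(\<integral>\<^sup>+n. ennreal (if n \<in> count_vectors p N then multinomial_mass p N q n else 0) \<partial>count_space UNIV)
      = (\<Sum>n\<in>count_vectors p N. ennreal (multinomial_mass p N q n))"
    by (subst nn_integral_count_space'[OF finite_count_vectors[of p N]]) auto
  also have "\<dots> = 1"
    using assms by (simp add: sum_ennreal nn multinomial_theorem prob_simplex_def)
  finally show "(\<integral>\<^sup>+n. ennreal (if n \<in> count_vectors p N then multinomial_mass p N q n else 0)
      \<partial>count_space UNIV) = 1" .
qed

text \<open>The law of $X$ when $N X$ is multinomial with $N$ trials and cell probabilities $A T$.\<close>

definition law_X :: "nat \<Rightarrow> nat \<Rightarrow> nat \<Rightarrow> (nat \<Rightarrow> nat \<Rightarrow> real) \<Rightarrow> (nat \<Rightarrow> real) \<Rightarrow> (nat \<Rightarrow> real) pmf" where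
  "law_X p K N A T =
     map_pmf (\<lambda>n. \<lambda>j\<in>{..<p}. real (n j) / real N) (multinomial_pmf p N (mat_vec p K A T))"

definition sparse_simplex :: "nat \<Rightarrow> real \<Rightarrow> nat \<Rightarrow> (nat \<Rightarrow> real) set" where
  "sparse_simplex K c_star s =
     {T \<in> prob_simplex K. card (vec_supp K T) = s \<and> (MIN k\<in>vec_supp K T. T k) \<ge> c_star / real s}"

definition estimators :: "nat \<Rightarrow> nat \<Rightarrow> ((nat \<Rightarrow> real) \<Rightarrow> nat \<Rightarrow> real) set" where
  "estimators p K =
     {T_hat \<in> (\<Pi>\<^sub>M j\<in>{..<p}. borel) \<rightarrow>\<^sub>M (\<Pi>\<^sub>M k\<in>{..<K}. borel).
        \<forall>x \<in> space (\<Pi>\<^sub>M j\<in>{..<p}. borel :: real measure). T_hat x \<in> prob_simplex K}"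

text \<open>
  The infimum and the supremum below are taken in the reals. This agrees with the extended
  reading for \<open>1 \<le> s \<le> K\<close> and \<open>c_star \<le> 1\<close>: probabilities lie in $[0,1]$, the uniform vector on
  \<open>s\<close> coordinates belongs to \<open>sparse_simplex K c_star s\<close>, and a constant map is an estimator.
\<close>

definition minimax_prob ::
    "nat \<Rightarrow> nat \<Rightarrow> nat \<Rightarrow> (nat \<Rightarrow> nat \<Rightarrow> real) \<Rightarrow> (nat \<Rightarrow> real) set \<Rightarrow> real \<Rightarrow> real" where
  "minimax_prob p K N A \<Theta> r =
     (INF T_hat\<in>estimators p K. SUP T\<in>\<Theta>.
        measure_pmf.prob (law_X p K N A T) {X. l1_norm K (\<lambda>k. T_hat X k - T k) \<ge> r})"

end

theory Submission
  imports Defs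
begin

text \<open>
  The proof is Assouad's hypercube method. Put mass \<open>1 / s\<close> on each of the first \<open>s\<close> coordinates
  and group them into \<open>m = s div 2\<close> consecutive pairs. For every set \<open>S\<close> of pairs, move a small mass
  \<open>g\<close> inside each pair, from the second coordinate to the first if the pair belongs to \<open>S\<close> and the
  other way otherwise. The resulting $2^m$ weight vectors stay in the simplex, and they stay above
  \<open>1 / (2 * s)\<close> on their support as long as \<open>g \<le> 1 / (2 * s)\<close>.

  Two neighbours, differing in one pair only, have chi-square distance at most $16 s g^2$. Multiplying
  by a column-stochastic matrix can only decrease this distance (\<open>chi_moment_mat_vec_le\<close>), so
  the same bound holds for the cell probabilities under any \<open>A\<close>. For \<open>N\<close> multinomial trials, one plus the distance gets raised to the
  \<open>N\<close>-th power (\<open>multinomial_chi_moment\<close>, an instance of the multinomial theorem). With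
  $g = 1 / (8 \sqrt{s N})$ the laws of neighbouring parameters therefore overlap in mass at least
  $1/2$ (\<open>multinomial_overlap\<close>), and no estimator can tell on which side a given pair is tilted. The
  hypothesis \<open>s \<le> N\<close> is what makes this \<open>g\<close> small enough for the weights to remain bounded below.

  Summed over the pairs, the error is at least of order $m g$, that is $\sqrt{s / N}$, on average over
  \<open>S\<close>. Truncating the error of each pair at \<open>g\<close> does not change this order and bounds the total by
  $m g$. A variable that is bounded by a multiple of its mean exceeds a fraction of its mean with
  probability bounded below, which turns the bound in mean into the bound in probability
  (\<open>assouad_prob\<close>).
\<close>

section \<open>Chi-square comparison of multinomial laws\<close>

text \<open>
  Cauchy--Schwarz in Engel form. The weights may vanish, which is why \<open>a\<close> has to be absolutely
  continuous with respect to \<open>b\<close>: the quotient is \<open>0\<close> where \<open>b\<close> vanishes.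
\<close>

lemma sum_square_le_weighted:
  fixes a b :: "'i \<Rightarrow> real"
  assumes b: "\<And>i. i \<in> I \<Longrightarrow> 0 \<le> b i" and ac: "\<And>i. i \<in> I \<Longrightarrow> b i = 0 \<Longrightarrow> a i = 0"
  shows "(\<Sum>i\<in>I. a i)\<^sup>2 \<le> (\<Sum>i\<in>I. b i) * (\<Sum>i\<in>I. (a i)\<^sup>2 / b i)"
proof -
  have "(\<Sum>i\<in>I. a i)\<^sup>2 = (\<Sum>i\<in>I. sqrt (b i) * (a i / sqrt (b i)))\<^sup>2"
    using ac by (intro arg_cong[where f = "\<lambda>x. x\<^sup>2"] sum.cong) auto
  also have "\<dots> \<le> (\<Sum>i\<in>I. (sqrt (b i))\<^sup>2) * (\<Sum>i\<in>I. (a i / sqrt (b i))\<^sup>2)"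
    by (rule Cauchy_Schwarz_ineq_sum)
  also have "\<dots> = (\<Sum>i\<in>I. b i) * (\<Sum>i\<in>I. (a i)\<^sup>2 / b i)"
    using b by (simp add: power_divide)
  finally show ?thesis .
qed

text \<open>
  For probability vectors with \<open>q\<close> absolutely continuous with respect to \<open>r\<close> this is one plus the
  chi-square divergence of \<open>q\<close> from \<open>r\<close>; the uncentred form is the one that is multiplicative over
  independent trials.
\<close>

definition chi_moment :: "nat \<Rightarrow> (nat \<Rightarrow> real) \<Rightarrow> (nat \<Rightarrow> real) \<Rightarrow> real" where
  "chi_moment d q r = (\<Sum>j<d. (q j)\<^sup>2 / r j)"

text \<open>
  The square of one multinomial mass divided by another is again a multinomial mass, with cell
  weights \<open>(q j)\<^sup>2 / r j\<close>, and these masses are summed by the multinomial theorem. With division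
  by zero equal to zero this is true for arbitrary real weights.
\<close>

lemma multinomial_chi_moment:
  "(\<Sum>n\<in>count_vectors p N. (multinomial_mass p N q n)\<^sup>2 / multinomial_mass p N r n)
     = chi_moment p q r ^ N"
proof -
  have "(multinomial_mass p N q n)\<^sup>2 / multinomial_mass p N r n
      = multinomial_mass p N (\<lambda>j. (q j)\<^sup>2 / r j) n" for n
  proof -
    have "(\<Prod>j<p. ((q j)\<^sup>2 / r j) ^ n j) = (\<Prod>j<p. q j ^ n j)\<^sup>2 / (\<Prod>j<p. r j ^ n j)"
      by (simp add: power_divide prod_dividef prod_power_distrib power_mult[symmetric] mult.commute)
    then show ?thesis
      by (simp add: multinomial_mass_def power2_eq_square divide_simps)
  qed
  then show ?thesis
    by (simp add: chi_moment_def multinomial_theorem)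
qed

lemma chi_moment_eq:
  assumes "(\<Sum>j<d. q j) = 1" "(\<Sum>j<d. r j) = 1" and ac: "\<And>j. j < d \<Longrightarrow> r j = 0 \<Longrightarrow> q j = 0"
  shows "chi_moment d q r = 1 + (\<Sum>j<d. (q j - r j)\<^sup>2 / r j)"
proof -
  have "(q j - r j)\<^sup>2 / r j = (q j)\<^sup>2 / r j - 2 * q j + r j" if "j < d" for j
    using ac[OF that] by (cases "r j = 0") (auto simp: power2_eq_square field_simps)
  then have "(\<Sum>j<d. (q j - r j)\<^sup>2 / r j) = (\<Sum>j<d. (q j)\<^sup>2 / r j - 2 * q j + r j)"
    by (intro sum.cong) auto
  also have "\<dots> = chi_moment d q r - 2 * (\<Sum>j<d. q j) + (\<Sum>j<d. r j)"
    by (simp add: chi_moment_def sum.distrib sum_subtractf sum_distrib_left)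
  finally show ?thesis using assms by simp
qed

lemma mat_vec_in_simplex:
  assumes A: "\<And>k. k < K \<Longrightarrow> mat_column p A k \<in> prob_simplex p" and T: "T \<in> prob_simplex K"
  shows "mat_vec p K A T \<in> prob_simplex p"
proof -
  have A0: "0 \<le> A j k" if "j < p" "k < K" for j k
    using A[OF that(2)] that by (auto simp: prob_simplex_def mat_column_def)
  have A1: "(\<Sum>j<p. A j k) = 1" if "k < K" for k
    using A[OF that] by (auto simp: prob_simplex_def mat_column_def)
  have "(\<Sum>j<p. \<Sum>k<K. A j k * T k) = (\<Sum>k<K. (\<Sum>j<p. A j k) * T k)"
    by (subst sum.swap) (simp add: sum_distrib_right)
  also have "\<dots> = 1"
    using T by (simp add: A1 prob_simplex_def)
  finally show ?thesis
    using A0 T by (auto simp: prob_simplex_def mat_vec_def intro!: sum_nonneg)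
qed

text \<open>
  Data processing: row by row, Cauchy--Schwarz with weights \<open>A j k * R k\<close> bounds the contribution
  of cell \<open>j\<close> by the sum of \<open>(T k)\<^sup>2 / R k\<close> with weights \<open>A j k\<close>, and these weights sum to one
  over \<open>j\<close>.
\<close>

lemma chi_moment_mat_vec_le:
  assumes A: "\<And>k. k < K \<Longrightarrow> mat_column p A k \<in> prob_simplex p"
    and R: "R \<in> prob_simplex K" and ac: "\<And>k. k < K \<Longrightarrow> R k = 0 \<Longrightarrow> T k = 0"
  shows "chi_moment p (mat_vec p K A T) (mat_vec p K A R) \<le> chi_moment K T R"
proof -
  have A0: "0 \<le> A j k" if "j < p" "k < K" for j k
    using A[OF that(2)] that by (auto simp: prob_simplex_def mat_column_def)
  have A1: "(\<Sum>j<p. A j k) = 1" if "k < K" for k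
    using A[OF that] by (auto simp: prob_simplex_def mat_column_def)
  have R0: "0 \<le> R k" if "k < K" for k
    using R that by (auto simp: prob_simplex_def)
  have "(mat_vec p K A T j)\<^sup>2 / mat_vec p K A R j \<le> (\<Sum>k<K. A j k * ((T k)\<^sup>2 / R k))"
    if j: "j < p" for j
  proof -
    let ?u = "\<Sum>k<K. A j k * R k" and ?v = "\<Sum>k<K. A j k * ((T k)\<^sup>2 / R k)"
    have "(\<Sum>k<K. A j k * T k)\<^sup>2 \<le> ?u * (\<Sum>k<K. (A j k * T k)\<^sup>2 / (A j k * R k))"
      using A0[OF j] R0 ac by (intro sum_square_le_weighted) auto
    also have "(\<Sum>k<K. (A j k * T k)\<^sup>2 / (A j k * R k)) = ?v"
      by (intro sum.cong) (auto simp: power2_eq_square)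
    finally have "(\<Sum>k<K. A j k * T k)\<^sup>2 \<le> ?u * ?v" .
    moreover have "0 \<le> ?u" "0 \<le> ?v"
      using A0[OF j] R0 by (auto intro!: sum_nonneg)
    ultimately have "(\<Sum>k<K. A j k * T k)\<^sup>2 / ?u \<le> ?v"
      by (cases "?u = 0") (auto simp: divide_le_eq mult.commute)
    then show ?thesis using j by (simp add: mat_vec_def)
  qed
  then have "chi_moment p (mat_vec p K A T) (mat_vec p K A R)
      \<le> (\<Sum>j<p. \<Sum>k<K. A j k * ((T k)\<^sup>2 / R k))"
    unfolding chi_moment_def by (intro sum_mono) auto
  also have "\<dots> = (\<Sum>k<K. (\<Sum>j<p. A j k) * ((T k)\<^sup>2 / R k))"
    by (subst sum.swap) (simp only: sum_distrib_right)
  also have "\<dots> = chi_moment K T R"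
    by (simp add: A1 chi_moment_def)
  finally show ?thesis .
qed

text \<open>
  The overlap of two laws is one minus half their $L^1$ distance, and by Cauchy--Schwarz the squared
  $L^1$ distance is at most the chi-square divergence.
\<close>

lemma multinomial_overlap:
  assumes q: "q \<in> prob_simplex p" and r: "r \<in> prob_simplex p"
    and ac: "\<And>j. j < p \<Longrightarrow> r j = 0 \<Longrightarrow> q j = 0"
  shows "(\<Sum>n\<in>count_vectors p N. min (pmf (multinomial_pmf p N q) n) (pmf (multinomial_pmf p N r) n))
     \<ge> 1 - sqrt (chi_moment p q r ^ N - 1) / 2"
proof -
  let ?X = "count_vectors p N"
  let ?P = "multinomial_mass p N q" and ?Q = "multinomial_mass p N r"
  have r0: "0 \<le> r j" if "j < p" for j using r that by (auto simp: prob_simplex_def)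
  have Q0: "0 \<le> ?Q n" for n
    using r0 by (auto simp: multinomial_mass_def intro!: mult_nonneg_nonneg divide_nonneg_nonneg prod_nonneg)
  have PQ: "?P n = 0" if "?Q n = 0" for n
    using that ac by (auto simp: multinomial_mass_def)
  have SP: "(\<Sum>n\<in>?X. ?P n) = 1" and SQ: "(\<Sum>n\<in>?X. ?Q n) = 1"
    using q r by (simp_all add: multinomial_theorem prob_simplex_def)
  have "(\<Sum>n\<in>?X. \<bar>?P n - ?Q n\<bar>)\<^sup>2 \<le> (\<Sum>n\<in>?X. ?Q n) * (\<Sum>n\<in>?X. \<bar>?P n - ?Q n\<bar>\<^sup>2 / ?Q n)"
    using Q0 PQ by (intro sum_square_le_weighted) auto
  also have "\<dots> = (\<Sum>n\<in>?X. (?P n)\<^sup>2 / ?Q n - 2 * ?P n + ?Q n)"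
  proof -
    have "\<bar>?P n - ?Q n\<bar>\<^sup>2 / ?Q n = (?P n)\<^sup>2 / ?Q n - 2 * ?P n + ?Q n" for n
      using PQ[of n] by (cases "?Q n = 0") (auto simp: power2_eq_square field_simps)
    then show ?thesis by (simp add: SQ)
  qed
  also have "\<dots> = chi_moment p q r ^ N - 1"
    by (simp add: sum.distrib sum_subtractf sum_distrib_left[symmetric] multinomial_chi_moment SP SQ)
  finally have "(\<Sum>n\<in>?X. \<bar>?P n - ?Q n\<bar>) \<le> sqrt (chi_moment p q r ^ N - 1)"
    by (rule real_le_rsqrt)
  moreover have "(\<Sum>n\<in>?X. min (?P n) (?Q n)) = (\<Sum>n\<in>?X. (?P n + ?Q n - \<bar>?P n - ?Q n\<bar>) / 2)"
    by (intro sum.cong) (auto simp: min_def)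
  moreover have "\<dots> = 1 - (\<Sum>n\<in>?X. \<bar>?P n - ?Q n\<bar>) / 2"
    by (simp add: sum_divide_distrib[symmetric] sum.distrib sum_subtractf SP SQ diff_divide_distrib)
  ultimately show ?thesis
    using q r by (simp add: pmf_multinomial)
qed

section \<open>Assouad's argument for probabilities\<close>

definition flip :: "nat \<Rightarrow> nat set \<Rightarrow> nat set" where
  "flip i S = (if i \<in> S then S - {i} else insert i S)"

lemma flip_flip [simp]: "flip i (flip i S) = S"
  by (auto simp: flip_def)

lemma mem_flip: "k \<in> flip i S \<longleftrightarrow> (if k = i then k \<notin> S else k \<in> S)"
  by (auto simp: flip_def)

lemma flip_subset: "i < m \<Longrightarrow> S \<subseteq> {..<m} \<Longrightarrow> flip i S \<subseteq> {..<m}"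
  by (auto simp: flip_def)

lemma sum_flip:
  assumes "i < m"
  shows "(\<Sum>S\<in>Pow {..<m}. f (flip i S)) = (\<Sum>S\<in>Pow {..<m}. f S)"
  by (rule sum.reindex_bij_witness[of _ "flip i" "flip i"]) (use flip_subset[OF assms] in auto)

text \<open>
  Markov's inequality reversed: values below \<open>r\<close> contribute at most \<open>r\<close> to the mean, so the excess
  of the mean over \<open>r\<close> comes from the event \<open>f \<ge> r\<close>, on which \<open>f \<le> M\<close>.
\<close>

lemma prob_ge_from_mean:
  fixes P :: "'x pmf" and f :: "'x \<Rightarrow> real"
  assumes "finite X" and M: "\<And>x. x \<in> X \<Longrightarrow> f x \<le> M" "0 < M" and r: "0 \<le> r"
    and mean: "(\<Sum>x\<in>X. pmf P x * f x) \<ge> r + \<delta> * M"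
  shows "measure_pmf.prob P {x. f x \<ge> r} \<ge> \<delta>"
proof -
  let ?B = "{x\<in>X. f x \<ge> r}"
  have "pmf P x * f x \<le> r * pmf P x + (if f x \<ge> r then M * pmf P x else 0)" if "x \<in> X" for x
  proof (cases "f x \<ge> r")
    case True
    have "pmf P x * f x \<le> M * pmf P x" using M(1)[OF that] by (simp add: mult.commute mult_right_mono)
    moreover have "0 \<le> r * pmf P x" using r by simp
    ultimately show ?thesis using True by simp
  next
    case False
    then show ?thesis by (simp add: mult.commute mult_right_mono)
  qed
  then have "(\<Sum>x\<in>X. pmf P x * f x) \<le> (\<Sum>x\<in>X. r * pmf P x + (if f x \<ge> r then M * pmf P x else 0))"
    by (rule sum_mono)
  also have "\<dots> = r * measure_pmf.prob P X + M * measure_pmf.prob P ?B"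
    using assms(1)
    by (simp add: sum.distrib measure_measure_pmf_finite sum_distrib_left sum.inter_filter
        if_distrib[of "(*) M"] cong: if_cong)
  also have "\<dots> \<le> r * 1 + M * measure_pmf.prob P {x. f x \<ge> r}"
    using r M(2) by (intro add_mono mult_left_mono measure_pmf.finite_measure_mono) auto
  finally have "\<delta> * M \<le> measure_pmf.prob P {x. f x \<ge> r} * M"
    using mean by (simp add: mult.commute)
  then show ?thesis using M(2) by simp
qed

text \<open>
  Vertices \<open>S\<close> and \<open>flip i S\<close> of the hypercube cannot both have a small \<open>i\<close>-th loss, so on the common
  part of their laws one of them pays. Pairing the vertices along every direction \<open>i\<close> and averaging
  over the cube shows that some vertex has a large total expected loss.
\<close>

lemma assouad_prob:
  fixes P :: "nat set \<Rightarrow> 'x pmf" and L :: "nat \<Rightarrow> nat set \<Rightarrow> 'x \<Rightarrow> real"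
  assumes X: "finite X" and m: "0 < m" and g: "0 < g" and \<alpha>: "0 \<le> \<alpha>"
    and L0: "\<And>i S x. i < m \<Longrightarrow> 0 \<le> L i S x"
    and sep: "\<And>i S x. i < m \<Longrightarrow> S \<subseteq> {..<m} \<Longrightarrow> 2 * g \<le> L i S x + L i (flip i S) x"
    and overlap: "\<And>i S. i < m \<Longrightarrow> S \<subseteq> {..<m} \<Longrightarrow>
        \<alpha> \<le> (\<Sum>x\<in>X. min (pmf (P S) x) (pmf (P (flip i S)) x))"
  shows "\<exists>S\<subseteq>{..<m}. measure_pmf.prob (P S) {x. (\<Sum>i<m. L i S x) \<ge> \<alpha> * real m * g / 4} \<ge> \<alpha> / 4"
proof -
  \<comment> \<open>Truncation keeps half of the separation and makes the loss bounded, so that a large mean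
    forces a large probability.\<close>
  define l where "l i S x = min (L i S x) g" for i S x
  have l0: "0 \<le> l i S x" and lg: "l i S x \<le> g" if "i < m" for i S x
    using L0[OF that] g by (auto simp: l_def)
  have lsep: "g \<le> l i S x + l i (flip i S) x" if "i < m" "S \<subseteq> {..<m}" for i S x
    using sep[OF that, of x] L0[OF that(1), of S x] L0[OF that(1), of "flip i S" x] g
    by (auto simp: l_def min_def)
  define E where "E i S = (\<Sum>x\<in>X. pmf (P S) x * l i S x)" for i S
  have pair: "\<alpha> * g \<le> E i S + E i (flip i S)" if iS: "i < m" "S \<subseteq> {..<m}" for i S
  proof -
    let ?p = "\<lambda>x. pmf (P S) x" and ?q = "\<lambda>x. pmf (P (flip i S)) x"
    have "\<alpha> * g \<le> (\<Sum>x\<in>X. min (?p x) (?q x)) * g"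
      using overlap[OF iS] g by (intro mult_right_mono) auto
    also have "\<dots> = (\<Sum>x\<in>X. min (?p x) (?q x) * g)"
      by (rule sum_distrib_right)
    also have "\<dots> \<le> (\<Sum>x\<in>X. ?p x * l i S x + ?q x * l i (flip i S) x)"
    proof (rule sum_mono)
      fix x
      have "min (?p x) (?q x) * g \<le> min (?p x) (?q x) * (l i S x + l i (flip i S) x)"
        using lsep[OF iS] by (intro mult_left_mono) auto
      also have "\<dots> \<le> ?p x * l i S x + ?q x * l i (flip i S) x"
        unfolding distrib_left using l0[OF iS(1)] by (intro add_mono mult_right_mono) auto
      finally show "min (?p x) (?q x) * g \<le> ?p x * l i S x + ?q x * l i (flip i S) x" .
    qed
    finally show ?thesis by (simp add: E_def sum.distrib)
  qed
  let ?C = "Pow {..<m}"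
  have coord: "(\<Sum>S\<in>?C. \<alpha> * g / 2) \<le> (\<Sum>S\<in>?C. E i S)" if "i < m" for i
  proof -
    have "(\<Sum>S\<in>?C. \<alpha> * g) \<le> (\<Sum>S\<in>?C. E i S + E i (flip i S))"
      using pair[OF that] by (intro sum_mono) auto
    then have "(\<Sum>S\<in>?C. \<alpha> * g) \<le> 2 * (\<Sum>S\<in>?C. E i S)"
      unfolding sum.distrib sum_flip[OF that] by simp
    then show ?thesis
      unfolding sum_divide_distrib[symmetric] by linarith
  qed
  have "(\<Sum>S\<in>?C. real m * (\<alpha> * g / 2)) = (\<Sum>i<m. \<Sum>S\<in>?C. \<alpha> * g / 2)"
    by simp
  also have "\<dots> \<le> (\<Sum>i<m. \<Sum>S\<in>?C. E i S)"
    by (rule sum_mono) (rule coord, simp)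
  also have "\<dots> = (\<Sum>S\<in>?C. \<Sum>i<m. E i S)"
    by (rule sum.swap)
  finally have "\<exists>S\<in>?C. real m * (\<alpha> * g / 2) \<le> (\<Sum>i<m. E i S)"
    using sum_strict_mono[of ?C "\<lambda>S. \<Sum>i<m. E i S" "\<lambda>S. real m * (\<alpha> * g / 2)"]
    by (metis Pow_not_empty finite_Pow_iff finite_lessThan not_le)
  then obtain S where S: "S \<subseteq> {..<m}" and ES: "real m * (\<alpha> * g / 2) \<le> (\<Sum>i<m. E i S)"
    by auto
  have "(\<Sum>i<m. E i S) = (\<Sum>x\<in>X. pmf (P S) x * (\<Sum>i<m. l i S x))"
    unfolding E_def by (subst sum.swap) (simp add: sum_distrib_left)
  then have "(\<Sum>x\<in>X. pmf (P S) x * (\<Sum>i<m. l i S x)) \<ge> \<alpha> * real m * g / 4 + \<alpha> / 4 * (real m * g)"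
    using ES by (simp add: field_simps)
  moreover have "(\<Sum>i<m. l i S x) \<le> real m * g" for x
    using sum_mono[of "{..<m}" "\<lambda>i. l i S x" "\<lambda>_. g"] lg by auto
  ultimately have "\<alpha> / 4 \<le> measure_pmf.prob (P S) {x. (\<Sum>i<m. l i S x) \<ge> \<alpha> * real m * g / 4}"
    using m g \<alpha> X by (intro prob_ge_from_mean[where X = X and M = "real m * g"]) auto
  also have "\<dots> \<le> measure_pmf.prob (P S) {x. (\<Sum>i<m. L i S x) \<ge> \<alpha> * real m * g / 4}"
  proof (rule measure_pmf.finite_measure_mono)
    have "(\<Sum>i<m. l i S x) \<le> (\<Sum>i<m. L i S x)" for x
      by (intro sum_mono) (simp add: l_def)
    then show "{x. (\<Sum>i<m. l i S x) \<ge> \<alpha> * real m * g / 4} \<subseteq> {x. (\<Sum>i<m. L i S x) \<ge> \<alpha> * real m * g / 4}"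
      by (auto intro: order_trans)
  qed simp
  finally show ?thesis using S by auto
qed

section \<open>The perturbed uniform weights\<close>

text \<open>
  Coordinates \<open>2 * i\<close> and \<open>2 * i + 1\<close> form pair \<open>i\<close>. They get opposite signs, so that tilting a pair
  preserves the total mass.
\<close>

definition pair_sign :: "nat set \<Rightarrow> nat \<Rightarrow> real" where
  "pair_sign S k = (if k div 2 \<in> S then 1 else -1) * (if even k then 1 else -1)"

text \<open>For odd \<open>s\<close> the coordinate \<open>s - 1\<close> has no partner and keeps the uniform weight.\<close>

definition weights :: "nat \<Rightarrow> nat \<Rightarrow> real \<Rightarrow> nat set \<Rightarrow> nat \<Rightarrow> real" where
  "weights K s g S = (\<lambda>k\<in>{..<K}. if k < 2 * (s div 2) then 1 / real s + g * pair_sign S k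
     else if k < s then 1 / real s else 0)"

lemma sum_pairs:
  fixes f :: "nat \<Rightarrow> 'a :: comm_monoid_add"
  shows "(\<Sum>k<2 * m. f k) = (\<Sum>i<m. f (2 * i) + f (2 * i + 1))"
  by (induction m) (simp_all add: add.assoc)

lemma sum_pair_sign: "(\<Sum>k<2 * m. pair_sign S k) = 0"
  unfolding sum_pairs by (simp add: pair_sign_def)

lemma weights_pos:
  assumes "k < s" "s \<le> K" "0 \<le> g" "g \<le> 1 / (2 * real s)"
  shows "1 / (2 * real s) \<le> weights K s g S k"
proof -
  have "g * pair_sign S k = g \<or> g * pair_sign S k = - g"
    by (simp add: pair_sign_def)
  moreover have "1 / real s = 1 / (2 * real s) + 1 / (2 * real s)"
    using assms(1) by (simp add: field_simps)
  moreover have "weights K s g S k = 1 / real s + g * pair_sign S k \<or> weights K s g S k = 1 / real s"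
    using assms(1,2) by (auto simp: weights_def)
  ultimately show ?thesis using assms(3,4) by linarith
qed

lemma weights_zero: "s \<le> k \<Longrightarrow> k < K \<Longrightarrow> weights K s g S k = 0"
  by (auto simp: weights_def)

lemma weights_in_simplex:
  assumes "0 < s" "s \<le> K" "0 \<le> g" "g \<le> 1 / (2 * real s)"
  shows "weights K s g S \<in> prob_simplex K"
proof -
  let ?m = "s div 2"
  have nn: "0 \<le> weights K s g S k" if "k < K" for k
  proof (cases "k < s")
    case True
    have "0 \<le> 1 / (2 * real s)" by simp
    then show ?thesis using weights_pos[OF True assms(2-4), of S] by linarith
  qed (simp add: weights_zero that)
  have "(\<Sum>k<K. weights K s g S k) = (\<Sum>k<s. weights K s g S k)"
    using assms(2) by (intro sum.mono_neutral_right) (auto simp: weights_zero)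
  also have "\<dots> = (\<Sum>k<s. 1 / real s + (if k < 2 * ?m then g * pair_sign S k else 0))"
    using assms(2) by (intro sum.cong) (auto simp: weights_def)
  also have "\<dots> = 1 + (\<Sum>k<s. if k < 2 * ?m then g * pair_sign S k else 0)"
    using assms(1) by (simp add: sum.distrib)
  also have "(\<Sum>k<s. if k < 2 * ?m then g * pair_sign S k else 0) = (\<Sum>k<2 * ?m. g * pair_sign S k)"
    by (intro sum.mono_neutral_cong_right) auto
  also have "\<dots> = 0"
    by (simp add: sum_distrib_left[symmetric] sum_pair_sign)
  finally show ?thesis
    using nn by (auto simp: prob_simplex_def weights_def)
qed

lemma weights_in_sparse_simplex:
  assumes "0 < s" "s \<le> K" "0 \<le> g" "g \<le> 1 / (2 * real s)"
  shows "weights K s g S \<in> sparse_simplex K (1 / 2) s"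
proof -
  have pos: "0 < weights K s g S k" if "k < s" for k
  proof -
    have "0 < 1 / (2 * real s)" using assms(1) by simp
    then show ?thesis using weights_pos[OF that assms(2-4), of S] by linarith
  qed
  have supp: "vec_supp K (weights K s g S) = {..<s}"
  proof (rule set_eqI)
    fix k
    show "k \<in> vec_supp K (weights K s g S) \<longleftrightarrow> k \<in> {..<s}"
      using pos[of k] weights_zero[of s k K g S] assms(2)
      by (cases "k < s") (auto simp: vec_supp_def)
  qed
  have "1 / 2 / real s \<le> (MIN k\<in>{..<s}. weights K s g S k)"
    using assms weights_pos[OF _ assms(2-4), of _ S] by (subst Min_ge_iff) (auto simp: mult.commute)
  then show ?thesis
    using weights_in_simplex[OF assms] by (simp add: sparse_simplex_def supp)
qed

lemma weights_flip_diff: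
  assumes "i < s div 2" "k < K"
  shows "\<bar>weights K s g (flip i S) k - weights K s g S k\<bar> = (if k div 2 = i then 2 * \<bar>g\<bar> else 0)"
  using assms by (auto simp: weights_def pair_sign_def mem_flip)

text \<open>
  Two coordinates change, each by \<open>2 * g\<close>, and are divided by weights at least \<open>1 / (2 * s)\<close>.
\<close>

lemma chi_moment_weights_le:
  assumes "0 < s" "s \<le> K" "0 \<le> g" "g \<le> 1 / (2 * real s)" and i: "i < s div 2"
  shows "chi_moment K (weights K s g S) (weights K s g (flip i S)) \<le> 1 + 16 * real s * g\<^sup>2"
proof -
  let ?T = "weights K s g S" and ?R = "weights K s g (flip i S)"
  have pos: "1 / (2 * real s) \<le> ?R k" if "k < s" for k
    using that assms by (intro weights_pos) auto
  have ac: "?T k = 0" if "k < K" "?R k = 0" for k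
  proof (cases "k < s")
    case True
    have "0 < 1 / (2 * real s)" using assms(1) by simp
    then show ?thesis using pos[OF True] that by linarith
  qed (simp add: weights_zero that)
  have "chi_moment K ?T ?R = 1 + (\<Sum>k<K. (?T k - ?R k)\<^sup>2 / ?R k)"
    using weights_in_simplex[OF assms(1-4)] ac by (intro chi_moment_eq) (auto simp: prob_simplex_def)
  also have "(\<Sum>k<K. (?T k - ?R k)\<^sup>2 / ?R k) = (\<Sum>k\<in>{2 * i, 2 * i + 1}. (?T k - ?R k)\<^sup>2 / ?R k)"
  proof (rule sum.mono_neutral_right)
    show "\<forall>k\<in>{..<K} - {2 * i, 2 * i + 1}. (?T k - ?R k)\<^sup>2 / ?R k = 0"
    proof
      fix k assume "k \<in> {..<K} - {2 * i, 2 * i + 1}"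
      then have "k < K" "k div 2 \<noteq> i" by auto
      then show "(?T k - ?R k)\<^sup>2 / ?R k = 0"
        using weights_flip_diff[OF i, of k K g S] by simp
    qed
  qed (use assms in auto)
  also have "\<dots> \<le> (\<Sum>k\<in>{2 * i, 2 * i + 1}. 8 * real s * g\<^sup>2)"
  proof (rule sum_mono)
    fix k assume k: "k \<in> {2 * i, 2 * i + 1}"
    then have ks: "k < s" "k < K" "k div 2 = i" using assms by auto
    have "(?T k - ?R k)\<^sup>2 = \<bar>?R k - ?T k\<bar>\<^sup>2" by (simp add: power2_commute)
    also have "\<dots> = (2 * g)\<^sup>2"
      using weights_flip_diff[OF i ks(2), of g S] ks by (simp add: power2_eq_square)
    finally have sq: "(?T k - ?R k)\<^sup>2 = (2 * g)\<^sup>2" .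
    have u: "0 < 1 / (2 * real s)" using assms(1) by simp
    have "(?T k - ?R k)\<^sup>2 / ?R k \<le> (2 * g)\<^sup>2 / (1 / (2 * real s))"
      unfolding sq
      by (intro divide_left_mono mult_pos_pos pos[OF ks(1)] u less_le_trans[OF u pos[OF ks(1)]]) simp
    then show "(?T k - ?R k)\<^sup>2 / ?R k \<le> 8 * real s * g\<^sup>2"
      by (simp add: power2_eq_square mult_ac)
  qed
  also have "\<dots> = 16 * real s * g\<^sup>2" by simp
  finally show ?thesis by simp
qed

section \<open>The minimax lower bound\<close>

text \<open>
  The loss of pair \<open>i\<close> is the error at its first member \<open>2 * i\<close>, where neighbouring weights differ
  by \<open>2 * g\<close>. Stating the bound in terms of the counts avoids the rescaling by \<open>N\<close>, under which the
  law of the frequencies is only an image of the multinomial law.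
\<close>

lemma sparse_weights_lower_bound:
  fixes \<tau> :: "(nat \<Rightarrow> nat) \<Rightarrow> nat \<Rightarrow> real"
  assumes A: "\<And>k. k < K \<Longrightarrow> mat_column p A k \<in> prob_simplex p"
    and s: "1 < s" "s \<le> K" "s \<le> N"
  shows "\<exists>T\<in>sparse_simplex K (1 / 2) s.
     measure_pmf.prob (multinomial_pmf p N (mat_vec p K A T))
       {n. l1_norm K (\<lambda>k. \<tau> n k - T k) \<ge> 1 / 192 * sqrt (real s / real N)} \<ge> 1 / 8"
proof -
  define m where "m = s div 2"
  \<comment> \<open>With this tilt the chi-square divergence of neighbours is at most \<open>1 / (4 * N)\<close>, hence at most
    \<open>exp (1 / 4) - 1 \<le> 1\<close> after \<open>N\<close> trials.\<close>
  define g where "g = 1 / (8 * sqrt (real s * real N))"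
  let ?T = "weights K s g"
  let ?P = "\<lambda>S. multinomial_pmf p N (mat_vec p K A (?T S))"
  have sN: "0 < real s" "real s \<le> real N" "0 < real N" using s by auto
  have g: "0 < g" using sN by (simp add: g_def)
  have g2: "real s * g\<^sup>2 = 1 / (64 * real N)"
    using sN by (simp add: g_def power_divide power_mult_distrib)
  have "(real s)\<^sup>2 \<le> real s * real N"
    using sN by (simp add: power2_eq_square)
  then have "real s \<le> sqrt (real s * real N)" by (rule real_le_rsqrt)
  then have gs: "g \<le> 1 / (2 * real s)"
    using sN by (simp add: g_def field_simps)
  have simplex: "?T S \<in> prob_simplex K" for S
    using s g gs by (intro weights_in_simplex) auto
  have q: "mat_vec p K A (?T S) \<in> prob_simplex p" for S
    by (rule mat_vec_in_simplex[OF A simplex])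
  have T0: "?T S k = 0 \<longleftrightarrow> s \<le> k" if "k < K" for S k
  proof (cases "k < s")
    case True
    have "0 < 1 / (2 * real s)" using sN by simp
    then show ?thesis using weights_pos[OF True s(2) _ gs, of S] g True by linarith
  qed (simp add: weights_zero that)
  have overlap: "1 / 2 \<le> (\<Sum>n\<in>count_vectors p N. min (pmf (?P S) n) (pmf (?P (flip i S)) n))"
    if i: "i < m" for i S
  proof -
    let ?q = "mat_vec p K A (?T S)" and ?r = "mat_vec p K A (?T (flip i S))"
    have ac: "?q j = 0" if j: "j < p" "?r j = 0" for j
    proof -
      have A0: "0 \<le> A j k" if "k < K" for k
        using A[OF that] j(1) by (auto simp: prob_simplex_def mat_column_def)
      have R0: "0 \<le> ?T (flip i S) k" if "k < K" for k
        using simplex[of "flip i S"] that by (auto simp: prob_simplex_def)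
      have "(\<Sum>k<K. A j k * ?T (flip i S) k) = 0"
        using j by (simp add: mat_vec_def)
      then have "\<forall>k<K. A j k * ?T (flip i S) k = 0"
        using A0 R0 by (subst (asm) sum_nonneg_eq_0_iff) auto
      then have "\<forall>k<K. A j k * ?T S k = 0"
        using T0 by auto
      then show ?thesis using j(1) by (auto simp: mat_vec_def intro!: sum.neutral simp del: mult_eq_0_iff)
    qed
    have "chi_moment p ?q ?r \<le> chi_moment K (?T S) (?T (flip i S))"
      using T0 by (intro chi_moment_mat_vec_le A simplex) auto
    also have "\<dots> \<le> 1 + 16 * real s * g\<^sup>2"
      using s g gs i by (intro chi_moment_weights_le) (auto simp: m_def)
    also have "\<dots> = 1 + 1 / (4 * real N)"
      using g2 by (simp add: mult.assoc)
    also have "\<dots> \<le> exp (1 / (4 * real N))"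
      by (rule exp_ge_add_one_self)
    finally have "chi_moment p ?q ?r ^ N \<le> exp (1 / (4 * real N)) ^ N"
      using q[of "flip i S"] by (intro power_mono) (auto simp: chi_moment_def prob_simplex_def intro!: sum_nonneg)
    also have "\<dots> = exp (1 / 4)"
      using sN by (simp add: exp_of_nat_mult[symmetric])
    also have "\<dots> \<le> 2"
      using exp_bound[of "1 / 4 :: real"] by (simp add: power2_eq_square)
    finally have "sqrt (chi_moment p ?q ?r ^ N - 1) \<le> 1"
      by simp
    moreover have "1 - sqrt (chi_moment p ?q ?r ^ N - 1) / 2
        \<le> (\<Sum>n\<in>count_vectors p N. min (pmf (?P S) n) (pmf (?P (flip i S)) n))"
      by (rule multinomial_overlap) (use q ac in auto)
    ultimately show ?thesis by linarith
  qed
  have "\<exists>S\<subseteq>{..<m}. measure_pmf.prob (?P S)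
      {n. (\<Sum>i<m. \<bar>\<tau> n (2 * i) - ?T S (2 * i)\<bar>) \<ge> 1 / 2 * real m * g / 4} \<ge> 1 / 2 / 4"
  proof (rule assouad_prob[where X = "count_vectors p N"])
    fix i S n assume i: "i < m"
    then have "\<bar>?T (flip i S) (2 * i) - ?T S (2 * i)\<bar> = 2 * g"
      using weights_flip_diff[of i s "2 * i" K g S] s g by (auto simp: m_def)
    then show "2 * g \<le> \<bar>\<tau> n (2 * i) - ?T S (2 * i)\<bar> + \<bar>\<tau> n (2 * i) - ?T (flip i S) (2 * i)\<bar>"
      by linarith
  qed (use s g overlap finite_count_vectors in \<open>auto simp: m_def\<close>)
  then obtain S where S: "1 / 8 \<le> measure_pmf.prob (?P S)
      {n. (\<Sum>i<m. \<bar>\<tau> n (2 * i) - ?T S (2 * i)\<bar>) \<ge> real m * g / 8}"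
    by auto
  \<comment> \<open>The factor 3 is attained at \<open>s = 3\<close>, where one coordinate out of three is unpaired;
    the final constant is \<open>1 / 192 = 1 / (3 * 8 * 8)\<close>.\<close>
  have "s \<le> 3 * m" using s(1) unfolding m_def by presburger
  then have "real s / 3 \<le> real m" by linarith
  then have "real s / 3 * g / 8 \<le> real m * g / 8"
    using g by simp
  moreover have "real s / 3 * g / 8 = 1 / 192 * sqrt (real s / real N)"
  proof -
    have "real s = sqrt (real s) * sqrt (real s)" by simp
    then show ?thesis
      using sN unfolding g_def real_sqrt_mult real_sqrt_divide by (simp add: field_simps)
  qed
  ultimately have radius: "1 / 192 * sqrt (real s / real N) \<le> real m * g / 8"
    by simp
  have loss: "(\<Sum>i<m. \<bar>\<tau> n (2 * i) - ?T S (2 * i)\<bar>) \<le> l1_norm K (\<lambda>k. \<tau> n k - ?T S k)" for n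
  proof -
    have "(\<Sum>i<m. \<bar>\<tau> n (2 * i) - ?T S (2 * i)\<bar>)
        = (\<Sum>k\<in>(*) 2 ` {..<m}. \<bar>\<tau> n k - ?T S k\<bar>)"
      by (subst sum.reindex) (auto simp: inj_on_def)
    also have "\<dots> \<le> l1_norm K (\<lambda>k. \<tau> n k - ?T S k)"
      unfolding l1_norm_def using s(2) by (intro sum_mono2) (auto simp: m_def)
    finally show ?thesis .
  qed
  have "{n. (\<Sum>i<m. \<bar>\<tau> n (2 * i) - ?T S (2 * i)\<bar>) \<ge> real m * g / 8}
      \<subseteq> {n. l1_norm K (\<lambda>k. \<tau> n k - ?T S k) \<ge> 1 / 192 * sqrt (real s / real N)}"
    by (intro Collect_mono impI) (rule order_trans[OF radius order_trans[OF _ loss]])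
  then have "1 / 8 \<le> measure_pmf.prob (?P S)
      {n. l1_norm K (\<lambda>k. \<tau> n k - ?T S k) \<ge> 1 / 192 * sqrt (real s / real N)}"
    by (intro order_trans[OF S] measure_pmf.finite_measure_mono) simp_all
  moreover have "?T S \<in> sparse_simplex K (1 / 2) s"
    using s g gs by (intro weights_in_sparse_simplex) auto
  ultimately show ?thesis by blast
qed

lemma estimators_nonempty:
  assumes "0 < K"
  shows "estimators p K \<noteq> {}"
proof -
  let ?e = "\<lambda>k\<in>{..<K}. if k = 0 then 1 else (0::real)"
  have "?e \<in> prob_simplex K"
    using assms by (auto simp: prob_simplex_def)
  then have "(\<lambda>_. ?e) \<in> estimators p K"
    by (auto simp: estimators_def space_PiM prob_simplex_def)
  then show ?thesis by blast
qed

theorem theorem7: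
  shows "\<exists>c_star\<in>{0<..1::real}. \<exists>c_bar>0::real. \<forall>c\<in>{0<..c_bar}. \<exists>c0>0::real. \<exists>c1\<in>{0<..1::real}.
    \<forall>(p::nat) (K::nat) (N::nat) (s::nat) (A :: nat \<Rightarrow> nat \<Rightarrow> real).
      p > K \<longrightarrow> N \<ge> 1 \<longrightarrow> (\<forall>k<K. mat_column p A k \<in> prob_simplex p) \<longrightarrow>
      1 < s \<longrightarrow> s \<le> K \<longrightarrow> real s \<le> c * real N \<longrightarrow>
      minimax_prob p K N A (sparse_simplex K c_star s) (c0 * sqrt (real s / real N)) \<ge> c1"
proof -
  have "1 / 8 \<le> minimax_prob p K N A (sparse_simplex K (1 / 2) s) (1 / 192 * sqrt (real s / real N))"
    if c: "c \<in> {0<..1}" and A: "\<forall>k<K. mat_column p A k \<in> prob_simplex p"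
      and s: "1 < s" "s \<le> K" "real s \<le> c * real N"
    for c :: real and p K N s :: nat and A :: "nat \<Rightarrow> nat \<Rightarrow> real"
    unfolding minimax_prob_def
  proof (rule cINF_greatest)
    show "estimators p K \<noteq> {}" using s by (intro estimators_nonempty) auto
  next
    fix T_hat :: "(nat \<Rightarrow> real) \<Rightarrow> nat \<Rightarrow> real"
    let ?X = "\<lambda>n. \<lambda>j\<in>{..<p}. real (n j) / real N"
    let ?f = "\<lambda>T. measure_pmf.prob (law_X p K N A T)
        {X. l1_norm K (\<lambda>k. T_hat X k - T k) \<ge> 1 / 192 * sqrt (real s / real N)}"
    have "c * real N \<le> 1 * real N" using c by (intro mult_right_mono) auto
    then have "s \<le> N" using s(3) by linarith
    then obtain T where T: "T \<in> sparse_simplex K (1 / 2) s"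
      and "1 / 8 \<le> measure_pmf.prob (multinomial_pmf p N (mat_vec p K A T))
        {n. l1_norm K (\<lambda>k. T_hat (?X n) k - T k) \<ge> 1 / 192 * sqrt (real s / real N)}"
      using sparse_weights_lower_bound[of K p A s N "\<lambda>n. T_hat (?X n)"] A s by auto
    then have "1 / 8 \<le> ?f T"
      by (simp add: law_X_def vimage_def)
    also have "\<dots> \<le> (SUP T\<in>sparse_simplex K (1 / 2) s. ?f T)"
      using T by (intro cSUP_upper bdd_aboveI2[where M = 1]) auto
    finally show "1 / 8 \<le> (SUP T\<in>sparse_simplex K (1 / 2) s. ?f T)" .
  qed
  then show ?thesis
    by (intro bexI[of _ "1 / 2"] exI[of _ 1] conjI ballI exI[of _ "1 / 192"] bexI[of _ "1 / 8"]) auto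
qed

end
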